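(* Let $(\gamma_j)_{j\ge1}$ be a non-increasing sequence of positive real numbers with $\sum_{j=1}^{\infty}\gamma_j<\infty$, and let $\boldsymbol{\gamma}$ be the product weights $\gamma_{\mathfrak{u}}=\prod_{j\in\mathfrak{u}}\gamma_j$ for finite nonempty $\mathfrak{u}\subseteq\mathbb{N}$. Then the weighted star discrepancy is strongly polynomially tractable with $\varepsilon$-exponent at most $2$.
   Context: Notation: $[s]=\{1,2,\ldots,s\}$. Weighted star discrepancy: for an $N$-element point set $\mathcal{P}=\{\boldsymbol{x}_0,\ldots,\boldsymbol{x}_{N-1}\}$ in $[0,1)^s$ (points counted with multiplicity), the discrepancy function is $$\Delta(\alpha_1,\ldots,\alpha_s)=\frac{A_N\left(\prod_{i=1}^s[0,\alpha_i)\right)}{N}-\alpha_1\cdots\alpha_s ,$$ where $A_N(E)$ is the number of indices $n\in\{0,\ldots,N-1\}$ with $\boldsymbol{x}_n\in E$. For $\boldsymbol{z}\in[0,1]^s$ and $\mathfrak{u}\subseteq[s]$, $(\boldsymbol{z}_{\mathfrak{u}},1)$ denotes the vector $\boldsymbol{z}$ with all components whose indices are not in $\mathfrak{u}$ replaced by $1$. The weighted star discrepancy is $$D_{N,\boldsymbol{\gamma}}^{\ast}(\mathcal{P})=\sup_{\boldsymbol{z}\in[0,1]^s}\max_{\emptyset\neq\mathfrak{u}\subseteq[s]}\gamma_{\mathfrak{u}}\,|\Delta(\boldsymbol{z}_{\mathfrak{u}},1)| .$$ For $s,N\in\mathbb{N}$ let $\mathrm{disc}_{\boldsymbol{\gamma}}(N,s)=\inf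 D_{N,\boldsymbol{\gamma}}^{\ast}(\mathcal{P})$, the infimum taken over all $N$-element point sets $\mathcal{P}$ in $[0,1)^s$. For $\varepsilon\in(0,1)$ and $s\in\mathbb{N}$ let $N_{\min}(\varepsilon,s)=\min\{N\in\mathbb{N}:\mathrm{disc}_{\boldsymbol{\gamma}}(N,s)\le\varepsilon\}$. The weighted star discrepancy is strongly polynomially tractable if there exist nonnegative real numbers $C$ and $\alpha$ such that $N_{\min}(\varepsilon,s)\le C\varepsilon^{-\alpha}$ for all $s\in\mathbb{N}$ and all $\varepsilon\in(0,1)$. The infimum over all $\alpha>0$ for which this holds (for some $C$) is called the $\varepsilon$-exponent of strong polynomial tractability. *)

theory Defs
  imports "HOL-Analysis.Analysis"
begin

text \<open>
  A vector in dimension \<open>s\<close> is a function \<open>nat \<Rightarrow> real\<close> of which only the coordinates in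
  \<open>{1..s}\<close> matter. An \<open>N\<close>-element point set is an indexed family \<open>x 0, \<dots>, x (N - 1)\<close> of such
  vectors, so that points are counted with multiplicity.
\<close>

definition point_sets :: "nat \<Rightarrow> nat \<Rightarrow> (nat \<Rightarrow> nat \<Rightarrow> real) set" where
  "point_sets N s = {x. \<forall>n<N. x n \<in> {1..s} \<rightarrow> {0..<1}}"

definition counting :: "nat \<Rightarrow> (nat \<Rightarrow> nat \<Rightarrow> real) \<Rightarrow> (nat \<Rightarrow> real) set \<Rightarrow> nat" where
  "counting N x E = card {n. n < N \<and> x n \<in> E}"

definition discrepancy_fun ::
  "nat \<Rightarrow> nat \<Rightarrow> (nat \<Rightarrow> nat \<Rightarrow> real) \<Rightarrow> (nat \<Rightarrow> real) \<Rightarrow> real" where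
  "discrepancy_fun N s x \<alpha> =
     real (counting N x (\<Pi> i\<in>{1..s}. {0..<\<alpha> i})) / real N - (\<Prod>i\<in>{1..s}. \<alpha> i)"

definition project_one :: "nat set \<Rightarrow> (nat \<Rightarrow> real) \<Rightarrow> nat \<Rightarrow> real" where
  "project_one u z = (\<lambda>i. if i \<in> u then z i else 1)"

text \<open>For \<open>s \<ge> 1\<close> the maximum is over a finite nonempty set and the supremum is that of a
  nonempty bounded set of reals.\<close>

definition weighted_star_discrepancy ::
  "(nat set \<Rightarrow> real) \<Rightarrow> nat \<Rightarrow> nat \<Rightarrow> (nat \<Rightarrow> nat \<Rightarrow> real) \<Rightarrow> real" where
  "weighted_star_discrepancy w N s x =
     (SUP z\<in>{1..s} \<rightarrow> {0..1}.
        Max ((\<lambda>u. w u * \<bar>discrepancy_fun N s x (project_one u z)\<bar>) `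
             {u. u \<noteq> {} \<and> u \<subseteq> {1..s}}))"

definition disc :: "(nat set \<Rightarrow> real) \<Rightarrow> nat \<Rightarrow> nat \<Rightarrow> real" where
  "disc w N s = (INF x\<in>point_sets N s. weighted_star_discrepancy w N s x)"

text \<open>The value is \<open>\<infinity>\<close> if no \<open>N\<close> qualifies; otherwise the infimum is a minimum.\<close>

definition N_min :: "(nat set \<Rightarrow> real) \<Rightarrow> real \<Rightarrow> nat \<Rightarrow> enat" where
  "N_min w \<epsilon> s = (INF N\<in>{N. 1 \<le> N \<and> disc w N s \<le> \<epsilon>}. enat N)"

definition tractability_bound :: "(nat set \<Rightarrow> real) \<Rightarrow> real \<Rightarrow> real \<Rightarrow> bool" where
  "tractability_bound w C \<alpha> \<longleftrightarrow>
     (\<forall>s\<ge>1. \<forall>\<epsilon>\<in>{0<..<1}. ereal_of_enat (N_min w \<epsilon> s) \<le> ereal (C * \<epsilon> powr (- \<alpha>)))"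

definition strongly_polynomially_tractable :: "(nat set \<Rightarrow> real) \<Rightarrow> bool" where
  "strongly_polynomially_tractable w \<longleftrightarrow> (\<exists>C\<ge>0. \<exists>\<alpha>\<ge>0. tractability_bound w C \<alpha>)"

text \<open>Extended-real valued, so that the infimum of the empty set is \<open>\<infinity>\<close>.\<close>

definition eps_exponent :: "(nat set \<Rightarrow> real) \<Rightarrow> ereal" where
  "eps_exponent w = (INF \<alpha>\<in>{\<alpha>. 0 < \<alpha> \<and> (\<exists>C\<ge>0. tractability_bound w C \<alpha>)}. ereal \<alpha>)"

definition product_weights :: "(nat \<Rightarrow> real) \<Rightarrow> nat set \<Rightarrow> real" where
  "product_weights \<gamma> u = (\<Prod>j\<in>u. \<gamma> j)"

end

theory Submission
  imports Defs
begin

text \<open>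
  Since the weights form a product, \<open>\<Sum>\<^bsub>u\<^esub> exp |u| * \<gamma> u = \<Prod>\<^bsub>j\<^esub> (1 + e * \<gamma> j)\<close> over all
  \<open>u \<subseteq> {1..s}\<close>, and this is at most \<open>D = exp (e * \<Sum>\<^bsub>j\<^esub> \<gamma> j)\<close>, whatever \<open>s\<close> is
  (\<open>sum_product_weights_le\<close>). Discrepancies never exceed 1, so for accuracy \<open>\<epsilon>\<close> only the sets \<open>u\<close>
  of weight above \<open>\<epsilon>\<close> matter; by the bound there are at most \<open>D / \<epsilon>\<close> of them, and each has at
  most \<open>ln (D / \<epsilon>)\<close> elements. The dimension has disappeared from the problem.

  For the remaining sets, the \<open>z\<close>-coordinates can be rounded up to a grid of mesh \<open>1 / m\<close>, at the
  cost of \<open>|u| / m\<close> in the discrepancy. This leaves finitely many boxes, \<open>(m + 1) ^ |u|\<close> for each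
  \<open>u\<close>. If the \<open>N\<close> points were drawn uniformly from the grid, a Hoeffding type bound would give
  discrepancy at most \<open>\<eta>\<close> in all boxes at once as soon as \<open>N * \<eta>\<^sup>2\<close> exceeds a multiple of the
  logarithm of the number of boxes. The proof uses the derandomised form of this argument: the
  points are chosen one after the other so that the sum of the exponential moments grows by at
  most its average factor (\<open>potential_step\<close>, \<open>balanced_sequence\<close>,
  \<open>exists_low_discrepancy_points\<close>). Every average is then a finite sum over the grid.

  With \<open>m\<close> polynomial in \<open>1 / \<epsilon>\<close>, the logarithm of the number of boxes is of order
  \<open>(ln (1 / \<epsilon>))\<^sup>2\<close>, so that \<open>N\<close> of order \<open>\<epsilon> powr (-2) * (ln (1 / \<epsilon>))\<^sup>2\<close> points suffice
  (\<open>disc_le_of_large_N\<close>). The logarithms are absorbed by any power of \<open>1 / \<epsilon>\<close>, hence every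
  \<open>\<alpha> > 2\<close> is admissible and the exponent is at most 2.
\<close>

section \<open>Balancing finitely many centred functions\<close>

lemma exp_le_quadratic:
  fixes y :: real
  assumes "\<bar>y\<bar> \<le> 1"
  shows "exp y \<le> 1 + y + y\<^sup>2"
proof (cases "0 \<le> y")
  case True
  with assms show ?thesis by (intro exp_bound) auto
next
  case False
  define t where "t = - y"
  have t: "0 \<le> t" "t \<le> 1" using False assms by (auto simp: t_def)
  have "1 \<le> (1 - t + t\<^sup>2) * (1 + t + t\<^sup>2 / 2)"
  proof -
    have "(1 - t + t\<^sup>2) * (1 + t + t\<^sup>2 / 2) = 1 + t\<^sup>2 / 2 + t ^ 3 / 2 + t ^ 4 / 2"
      by (simp add: field_simps power2_eq_square power3_eq_cube power4_eq_xxxx)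
    thus ?thesis using t by simp
  qed
  also have "\<dots> \<le> (1 - t + t\<^sup>2) * exp t"
    using exp_lower_Taylor_quadratic[OF t(1)] t by (intro mult_left_mono) auto
  finally have "exp (- t) \<le> 1 - t + t\<^sup>2"
    by (simp add: exp_minus field_simps)
  thus ?thesis by (simp add: t_def)
qed

text \<open>
  The sum of \<open>2 * cosh (l * S t)\<close>: a smooth substitute for the maximum of all \<open>\<bar>S t\<bar>\<close>,
  whose average over the choice of the next point can be computed.
\<close>

definition potential :: "real \<Rightarrow> 'b set \<Rightarrow> ('b \<Rightarrow> real) \<Rightarrow> real" where
  "potential l T S = (\<Sum>t\<in>T. exp (l * S t) + exp (- l * S t))"

text \<open>
  The bound on the moment generating function behind Hoeffding's inequality: the linear term of
  the quadratic bound averages to 0.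
\<close>

lemma sum_exp_le:
  fixes f :: "'a \<Rightarrow> real"
  assumes "finite \<Omega>" "\<And>\<omega>. \<omega> \<in> \<Omega> \<Longrightarrow> \<bar>f \<omega>\<bar> \<le> 1" "(\<Sum>\<omega>\<in>\<Omega>. f \<omega>) = 0" "\<bar>l\<bar> \<le> 1"
  shows "(\<Sum>\<omega>\<in>\<Omega>. exp (l * f \<omega>)) \<le> card \<Omega> * exp (l\<^sup>2)"
proof -
  have "exp (l * f \<omega>) \<le> (1 + l\<^sup>2) + l * f \<omega>" if "\<omega> \<in> \<Omega>" for \<omega>
  proof -
    have f: "\<bar>f \<omega>\<bar> \<le> 1" using assms(2) that .
    have "\<bar>l * f \<omega>\<bar> \<le> 1" using mult_le_one[OF assms(4) _ f] by (simp add: abs_mult)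
    hence "exp (l * f \<omega>) \<le> 1 + l * f \<omega> + l\<^sup>2 * (f \<omega>)\<^sup>2"
      using exp_le_quadratic[of "l * f \<omega>"] by (simp add: power_mult_distrib)
    moreover have "(f \<omega>)\<^sup>2 \<le> 1" using f by (simp add: abs_square_le_1)
    hence "l\<^sup>2 * (f \<omega>)\<^sup>2 \<le> l\<^sup>2" by (simp add: mult_left_le)
    ultimately show ?thesis by linarith
  qed
  hence "(\<Sum>\<omega>\<in>\<Omega>. exp (l * f \<omega>)) \<le> (\<Sum>\<omega>\<in>\<Omega>. (1 + l\<^sup>2) + l * f \<omega>)"
    by (rule sum_mono)
  also have "\<dots> = card \<Omega> * (1 + l\<^sup>2)"
    using assms(3) by (simp add: sum.distrib sum_distrib_left[symmetric])
  also have "\<dots> \<le> card \<Omega> * exp (l\<^sup>2)"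
    by (intro mult_left_mono exp_ge_add_one_self) auto
  finally show ?thesis .
qed

text \<open>
  Averaged over \<open>\<omega>\<close>, the new potential is at most \<open>exp (l\<^sup>2)\<close> times the old one by
  \<open>sum_exp_le\<close>, used with \<open>l\<close> and \<open>- l\<close>; some \<open>\<omega>\<close> is no worse than the average.
\<close>

lemma potential_step:
  fixes f :: "'b \<Rightarrow> 'a \<Rightarrow> real"
  assumes "finite \<Omega>" "\<Omega> \<noteq> {}"
    and "\<And>t \<omega>. t \<in> T \<Longrightarrow> \<omega> \<in> \<Omega> \<Longrightarrow> \<bar>f t \<omega>\<bar> \<le> 1"
    and "\<And>t. t \<in> T \<Longrightarrow> (\<Sum>\<omega>\<in>\<Omega>. f t \<omega>) = 0" and "\<bar>l\<bar> \<le> 1"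
  shows "\<exists>\<omega>\<in>\<Omega>. potential l T (\<lambda>t. S t + f t \<omega>) \<le> exp (l\<^sup>2) * potential l T S"
proof (rule ccontr)
  assume "\<not> ?thesis"
  hence less: "\<And>\<omega>. \<omega> \<in> \<Omega> \<Longrightarrow> exp (l\<^sup>2) * potential l T S < potential l T (\<lambda>t. S t + f t \<omega>)"
    by force
  have "(\<Sum>\<omega>\<in>\<Omega>. potential l T (\<lambda>t. S t + f t \<omega>)) =
        (\<Sum>t\<in>T. exp (l * S t) * (\<Sum>\<omega>\<in>\<Omega>. exp (l * f t \<omega>)) +
                exp (- l * S t) * (\<Sum>\<omega>\<in>\<Omega>. exp (- l * f t \<omega>)))"
    unfolding potential_def
    by (subst sum.swap) (simp add: sum.distrib sum_distrib_left distrib_left exp_add[symmetric])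
  also have "\<dots> \<le> (\<Sum>t\<in>T. exp (l * S t) * (card \<Omega> * exp (l\<^sup>2)) +
                exp (- l * S t) * (card \<Omega> * exp ((- l)\<^sup>2)))"
    using assms by (intro sum_mono add_mono mult_left_mono sum_exp_le) auto
  also have "\<dots> = (\<Sum>\<omega>\<in>\<Omega>. exp (l\<^sup>2) * potential l T S)"
    by (simp add: potential_def sum_distrib_left sum.distrib algebra_simps)
  also have "\<dots> < (\<Sum>\<omega>\<in>\<Omega>. potential l T (\<lambda>t. S t + f t \<omega>))"
    using assms less by (intro sum_strict_mono) auto
  finally show False by simp
qed

text \<open>
  Iterating \<open>potential_step\<close> from the potential \<open>2 * card T\<close> of the zero sums bounds
  \<open>exp (l * \<bar>S t\<bar>)\<close> by \<open>2 * card T * exp (N * l\<^sup>2)\<close>. The choice \<open>l = \<eta> / 2\<close> minimises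
  \<open>N * l\<^sup>2 - N * l * \<eta>\<close>; the minimum \<open>- N * \<eta>\<^sup>2 / 4\<close> gives the form of the hypothesis on
  \<open>card T\<close>.
\<close>

lemma balanced_sequence:
  fixes f :: "'b \<Rightarrow> 'a \<Rightarrow> real"
  assumes "finite \<Omega>" "\<Omega> \<noteq> {}" "finite T"
    and "\<And>t \<omega>. t \<in> T \<Longrightarrow> \<omega> \<in> \<Omega> \<Longrightarrow> \<bar>f t \<omega>\<bar> \<le> 1"
    and "\<And>t. t \<in> T \<Longrightarrow> (\<Sum>\<omega>\<in>\<Omega>. f t \<omega>) = 0"
    and "0 < \<eta>" "\<eta> \<le> 1" and "2 * real (card T) \<le> exp (N * \<eta>\<^sup>2 / 4)"
  shows "\<exists>p. (\<forall>n::nat. p n \<in> \<Omega>) \<and> (\<forall>t\<in>T. \<bar>\<Sum>n<N. f t (p n)\<bar> \<le> N * \<eta>)"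
proof -
  define l where "l = \<eta> / 2"
  have l: "0 < l" "l \<le> 1" using assms by (auto simp: l_def)
  have "\<exists>p. (\<forall>n::nat. p n \<in> \<Omega>) \<and>
     potential l T (\<lambda>t. \<Sum>n<k. f t (p n)) \<le> exp (k * l\<^sup>2) * (2 * real (card T))" for k
  proof (induction k)
    case 0
    from \<open>\<Omega> \<noteq> {}\<close> obtain \<omega> where "\<omega> \<in> \<Omega>" by auto
    thus ?case by (intro exI[of _ "\<lambda>_. \<omega>"]) (simp add: potential_def)
  next
    case (Suc k)
    then obtain p where p: "\<And>n. p n \<in> \<Omega>"
      "potential l T (\<lambda>t. \<Sum>n<k. f t (p n)) \<le> exp (k * l\<^sup>2) * (2 * real (card T))" by auto
    obtain \<omega> where w: "\<omega> \<in> \<Omega>" "potential l T (\<lambda>t. (\<Sum>n<k. f t (p n)) + f t \<omega>)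
        \<le> exp (l\<^sup>2) * potential l T (\<lambda>t. \<Sum>n<k. f t (p n))"
      using potential_step[of \<Omega> T f l "\<lambda>t. \<Sum>n<k. f t (p n)"] assms l by auto
    have "potential l T (\<lambda>t. \<Sum>n<Suc k. f t ((p(k := \<omega>)) n))
        \<le> exp (l\<^sup>2) * potential l T (\<lambda>t. \<Sum>n<k. f t (p n))"
      using w(2) by simp
    also have "\<dots> \<le> exp (l\<^sup>2) * (exp (k * l\<^sup>2) * (2 * real (card T)))"
      using p(2) by (intro mult_left_mono) auto
    also have "\<dots> = exp (Suc k * l\<^sup>2) * (2 * real (card T))"
      by (simp add: exp_add[symmetric] algebra_simps)
    finally show ?case using p(1) w(1) by (intro exI[of _ "p(k := \<omega>)"]) auto
  qed
  then obtain p where p: "\<And>n. p n \<in> \<Omega>"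
    "potential l T (\<lambda>t. \<Sum>n<N. f t (p n)) \<le> exp (N * l\<^sup>2) * (2 * real (card T))" by blast
  have "\<bar>\<Sum>n<N. f t (p n)\<bar> \<le> N * \<eta>" if "t \<in> T" for t
  proof -
    let ?S = "\<Sum>n<N. f t (p n)"
    have "exp (l * \<bar>?S\<bar>) \<le> exp (l * ?S) + exp (- l * ?S)"
      by (cases "0 \<le> ?S") auto
    also have "\<dots> \<le> potential l T (\<lambda>t. \<Sum>n<N. f t (p n))"
      unfolding potential_def using that assms(3) by (intro member_le_sum) (auto intro: add_nonneg_nonneg)
    also have "\<dots> \<le> exp (N * l\<^sup>2) * (2 * real (card T))" by (rule p(2))
    also have "\<dots> \<le> exp (N * l\<^sup>2) * exp (N * \<eta>\<^sup>2 / 4)"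
      using assms by (intro mult_left_mono) auto
    also have "\<dots> = exp (l * (N * \<eta>))"
      by (simp add: exp_add[symmetric] l_def power2_eq_square)
    finally have "l * \<bar>?S\<bar> \<le> l * (N * \<eta>)" by simp
    thus ?thesis using l by simp
  qed
  thus ?thesis using p(1) by blast
qed

section \<open>Point sets on a grid\<close>

text \<open>
  Numerators of the points with coordinates in \<open>{0, 1 / m, \<dots>, (m - 1) / m}\<close>.
\<close>

definition grid :: "nat \<Rightarrow> nat \<Rightarrow> (nat \<Rightarrow> nat) set" where
  "grid s m = {1..s} \<rightarrow>\<^sub>E {..<m}"

text \<open>
  For the box with upper corner \<open>c / m\<close> in the coordinates \<open>u\<close>: the contribution of a single
  grid point to \<open>N\<close> times its discrepancy.
\<close>

definition corner_test :: "nat \<Rightarrow> nat set \<times> (nat \<Rightarrow> nat) \<Rightarrow> (nat \<Rightarrow> nat) \<Rightarrow> real" where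
  "corner_test m = (\<lambda>(u, c) p. of_bool (\<forall>i\<in>u. p i < c i) - (\<Prod>i\<in>u. c i / m))"

text \<open>
  For boxes with corner on the grid, counting grid points agrees exactly with volume. A uniform
  point of the cube can therefore be replaced by a uniform point of the finite grid.
\<close>

lemma sum_corner_test:
  assumes "u \<subseteq> {1..s}" "c \<in> u \<rightarrow> {..m}" "0 < m"
  shows "(\<Sum>p\<in>grid s m. corner_test m (u, c) p) = 0"
proof -
  have "{p \<in> grid s m. \<forall>i\<in>u. p i < c i} = ({1..s} \<rightarrow>\<^sub>E {..<m}) \<inter> {p. \<forall>i\<in>u. p i < c i}"
    by (auto simp: grid_def)
  also have "\<dots> = (\<Pi>\<^sub>E i\<in>{1..s}. {..<if i \<in> u then c i else m})"
  proof (intro equalityI subsetI)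
    fix p assume "p \<in> ({1..s} \<rightarrow>\<^sub>E {..<m}) \<inter> {p. \<forall>i\<in>u. p i < c i}"
    thus "p \<in> (\<Pi>\<^sub>E i\<in>{1..s}. {..<if i \<in> u then c i else m})"
      by (simp add: PiE_iff)
  next
    fix p assume p: "p \<in> (\<Pi>\<^sub>E i\<in>{1..s}. {..<if i \<in> u then c i else m})"
    have "p i < m" if "i \<in> {1..s}" for i
      using PiE_mem[OF p that] assms(2) by (cases "i \<in> u") (auto simp: Pi_iff intro: less_le_trans)
    moreover have "p i < c i" if "i \<in> u" for i
      using PiE_mem[OF p, of i] assms(1) that by auto
    ultimately show "p \<in> ({1..s} \<rightarrow>\<^sub>E {..<m}) \<inter> {p. \<forall>i\<in>u. p i < c i}"
      using p by (simp add: PiE_iff)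
  qed
  finally have "real (card {p \<in> grid s m. \<forall>i\<in>u. p i < c i})
      = (\<Prod>i\<in>{1..s}. real (if i \<in> u then c i else m))"
    by (simp add: card_PiE)
  also have "\<dots> = (\<Prod>i\<in>{1..s}. real m * (if i \<in> u then c i / m else 1))"
    using assms(3) by (intro prod.cong) auto
  also have "\<dots> = real m ^ s * (\<Prod>i\<in>u. c i / m)"
    using assms(1) by (simp add: prod.distrib prod.inter_restrict[symmetric] Int_absorb1 prod_dividef)
  finally show ?thesis
    by (simp add: corner_test_def sum_subtractf card_PiE grid_def Int_def finite_PiE)
qed

lemma abs_corner_test_le:
  assumes "c \<in> u \<rightarrow> {..m}" "0 < m"
  shows "\<bar>corner_test m (u, c) p\<bar> \<le> 1"
proof -
  have "0 \<le> (\<Prod>i\<in>u. c i / m)" "(\<Prod>i\<in>u. c i / m) \<le> 1"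
    using assms by (auto intro!: prod_nonneg prod_le_1 simp: Pi_iff)
  thus ?thesis by (auto simp: corner_test_def)
qed

text \<open>
  Coordinates outside \<open>u\<close> impose no condition, because all points lie below 1. Hence the
  discrepancy of a projection involves \<open>|u|\<close> coordinates only, not \<open>s\<close>.
\<close>

lemma discrepancy_fun_project_one:
  assumes "u \<subseteq> {1..s}" "x \<in> point_sets N s"
  shows "discrepancy_fun N s x (project_one u z)
     = card {n. n < N \<and> (\<forall>i\<in>u. x n i < z i)} / N - (\<Prod>i\<in>u. z i)"
proof -
  have "x n \<in> (\<Pi> i\<in>{1..s}. {0..<project_one u z i}) \<longleftrightarrow> (\<forall>i\<in>u. x n i < z i)" if "n < N" for n
    using assms that by (auto simp: point_sets_def project_one_def Pi_iff subset_iff)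
  hence "{n. n < N \<and> x n \<in> (\<Pi> i\<in>{1..s}. {0..<project_one u z i})}
      = {n. n < N \<and> (\<forall>i\<in>u. x n i < z i)}" by blast
  moreover have "(\<Prod>i\<in>{1..s}. project_one u z i) = (\<Prod>i\<in>u. z i)"
    using assms(1) by (simp add: project_one_def prod.inter_restrict[symmetric] Int_absorb1)
  ultimately show ?thesis by (simp add: discrepancy_fun_def counting_def)
qed

lemma discrepancy_fun_abs_le_1:
  assumes "u \<subseteq> {1..s}" "x \<in> point_sets N s" "z \<in> {1..s} \<rightarrow> {0..1}"
  shows "\<bar>discrepancy_fun N s x (project_one u z)\<bar> \<le> 1"
proof -
  have "card {n. n < N \<and> (\<forall>i\<in>u. x n i < z i)} \<le> card {..<N}" by (intro card_mono) auto
  hence "real (card {n. n < N \<and> (\<forall>i\<in>u. x n i < z i)}) / N \<le> 1" by (simp add: divide_le_eq)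
  moreover have "0 \<le> (\<Prod>i\<in>u. z i)" "(\<Prod>i\<in>u. z i) \<le> 1"
    using assms by (auto intro!: prod_nonneg prod_le_1 simp: Pi_iff subset_iff)
  moreover have "0 \<le> real (card {n. n < N \<and> (\<forall>i\<in>u. x n i < z i)}) / N" by simp
  ultimately show ?thesis
    unfolding discrepancy_fun_project_one[OF assms(1,2)] by linarith
qed

text \<open>
  The left side of the last hypothesis is twice the number of boxes to be balanced. The summand
  \<open>card u / m\<close> in the conclusion is the price of rounding the corner of a box to the grid.
\<close>

lemma exists_low_discrepancy_points:
  fixes U :: "nat set set"
  assumes "U \<subseteq> Pow {1..s}" "0 < m" "0 < N" "0 < \<eta>" "\<eta> \<le> 1"
    and large: "2 * (\<Sum>u\<in>U. real (m + 1) ^ card u) \<le> exp (N * \<eta>\<^sup>2 / 4)"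
  shows "\<exists>x\<in>point_sets N s. \<forall>u\<in>U. \<forall>z\<in>{1..s} \<rightarrow> {0..1}.
           \<bar>discrepancy_fun N s x (project_one u z)\<bar> \<le> \<eta> + card u / m"
proof -
  define T where "T = (SIGMA u:U. u \<rightarrow>\<^sub>E {..m})"
  have U: "finite U" "\<And>u. u \<in> U \<Longrightarrow> finite u"
    using assms(1) by (auto intro: finite_subset)
  have T: "finite T" unfolding T_def using U by (intro finite_SigmaI finite_PiE) auto
  have "real (card T) = (\<Sum>u\<in>U. real (m + 1) ^ card u)"
    unfolding T_def using U by (subst card_SigmaI) (auto intro: finite_PiE simp: card_PiE)
  hence "2 * real (card T) \<le> exp (N * \<eta>\<^sup>2 / 4)" using large by simp
  moreover have "finite (grid s m)" by (auto simp: grid_def intro: finite_PiE)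
  moreover have "(\<lambda>i\<in>{1..s}. 0) \<in> grid s m" using assms(2) by (auto simp: grid_def)
  hence "grid s m \<noteq> {}" by blast
  moreover have "\<bar>corner_test m t p\<bar> \<le> 1" "(\<Sum>p\<in>grid s m. corner_test m t p) = 0"
    if "t \<in> T" for t p
  proof -
    obtain u c where t: "t = (u, c)" "u \<in> U" "c \<in> u \<rightarrow> {..m}"
      using \<open>t \<in> T\<close> by (auto simp: T_def)
    show "\<bar>corner_test m t p\<bar> \<le> 1" "(\<Sum>p\<in>grid s m. corner_test m t p) = 0"
      using t assms(1,2) abs_corner_test_le[of c u m p] sum_corner_test[of u s c m] by auto
  qed
  ultimately obtain p where p: "\<And>n::nat. p n \<in> grid s m"
    and bal: "\<And>t. t \<in> T \<Longrightarrow> \<bar>\<Sum>n<N. corner_test m t (p n)\<bar> \<le> N * \<eta>"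
    using balanced_sequence[of "grid s m" T "corner_test m" \<eta> N] T assms(4,5) by blast
  define x where "x n i = real (p n i) / m" for n i
  have x: "x \<in> point_sets N s"
    using p assms(2) by (auto simp: point_sets_def x_def grid_def PiE_iff)
  have "\<bar>discrepancy_fun N s x (project_one u z)\<bar> \<le> \<eta> + card u / m"
    if u: "u \<in> U" and z: "z \<in> {1..s} \<rightarrow> {0..1}" for u z
  proof -
    have us: "u \<subseteq> {1..s}" using u assms(1) by auto
    have z01: "0 \<le> z i" "z i \<le> 1" if "i \<in> u" for i using z us that by (auto simp: Pi_iff)
    \<comment> \<open>Rounding up does not change which grid points lie in the box.\<close>
    define c where "c = (\<lambda>i\<in>u. nat \<lceil>m * z i\<rceil>)"
    have less: "k < c i \<longleftrightarrow> k / m < z i" if "i \<in> u" for i and k :: nat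
    proof -
      have "k < c i \<longleftrightarrow> int k < \<lceil>m * z i\<rceil>" using that by (simp add: c_def zless_nat_eq_int_zless)
      also have "\<dots> \<longleftrightarrow> k < m * z i" by (simp add: less_ceiling_iff)
      also have "\<dots> \<longleftrightarrow> k / m < z i" using assms(2) by (simp add: divide_less_eq mult.commute)
      finally show ?thesis .
    qed
    have cm: "c i \<le> m" if "i \<in> u" for i
      using z01[OF that] that by (simp add: c_def ceiling_le_iff mult_left_le)
    have cz: "\<bar>c i / m - z i\<bar> \<le> 1 / m" if "i \<in> u" for i
    proof -
      have "real (c i) = of_int \<lceil>m * z i\<rceil>"
        using z01[OF that] that by (simp add: c_def)
      hence "m * z i \<le> c i" "c i \<le> m * z i + 1" by linarith+
      moreover have "c i / m - z i = (c i - m * z i) / m"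
        using assms(2) by (simp add: field_simps)
      ultimately show ?thesis using assms(2) by (simp add: divide_right_mono)
    qed
    have "(u, c) \<in> T" using u cm by (auto simp: T_def c_def)
    from bal[OF this] have b: "\<bar>\<Sum>n<N. corner_test m (u, c) (p n)\<bar> \<le> N * \<eta>" .
    have "(\<Sum>n<N. corner_test m (u, c) (p n)) =
        card {n. n < N \<and> (\<forall>i\<in>u. x n i < z i)} - N * (\<Prod>i\<in>u. c i / m)"
      by (simp add: corner_test_def sum_subtractf x_def less Int_def)
    also have "\<dots> = N * (discrepancy_fun N s x (project_one u z)
        - ((\<Prod>i\<in>u. c i / m) - (\<Prod>i\<in>u. z i)))"
      using assms(3) by (simp add: discrepancy_fun_project_one[OF us x] field_simps)
    finally have "N * \<bar>discrepancy_fun N s x (project_one u z)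
        - ((\<Prod>i\<in>u. c i / m) - (\<Prod>i\<in>u. z i))\<bar> \<le> N * \<eta>"
      using b by (simp add: abs_mult)
    hence "\<bar>discrepancy_fun N s x (project_one u z) - ((\<Prod>i\<in>u. c i / m) - (\<Prod>i\<in>u. z i))\<bar> \<le> \<eta>"
      using assms(3) by simp
    moreover have "\<bar>(\<Prod>i\<in>u. c i / m) - (\<Prod>i\<in>u. z i)\<bar> \<le> (\<Sum>i\<in>u. \<bar>c i / m - z i\<bar>)"
      using norm_prod_diff[of u "\<lambda>i. c i / m" z] z01 cm assms(2) by (auto simp: divide_le_eq)
    moreover have "\<dots> \<le> card u * (1 / m)" using cz by (intro sum_bounded_above) auto
    ultimately show ?thesis by simp
  qed
  thus ?thesis using x by blast
qed

section \<open>Weights and tractability\<close>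

text \<open>
  As infima and suprema of reals have unspecified values on unbounded sets, passing from one
  point set to \<open>disc\<close> needs the weighted discrepancies of a fixed point set to be bounded above
  and those of all point sets to be bounded below.
\<close>

lemma disc_le:
  assumes "1 \<le> s" "x \<in> point_sets N s" "\<And>u. u \<subseteq> {1..s} \<Longrightarrow> 0 \<le> w u"
    and small: "\<And>u z. u \<noteq> {} \<Longrightarrow> u \<subseteq> {1..s} \<Longrightarrow> z \<in> {1..s} \<rightarrow> {0..1} \<Longrightarrow>
           w u * \<bar>discrepancy_fun N s x (project_one u z)\<bar> \<le> \<epsilon>"
  shows "disc w N s \<le> \<epsilon>"
proof -
  let ?U = "{u. u \<noteq> {} \<and> u \<subseteq> {1..s}}"
  let ?Z = "{1..s} \<rightarrow> {0..1} :: (nat \<Rightarrow> real) set"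
  let ?M = "\<lambda>y z. Max ((\<lambda>u. w u * \<bar>discrepancy_fun N s y (project_one u z)\<bar>) ` ?U)"
  have U: "finite ?U" "{1..s} \<in> ?U" using assms(1) by auto
  hence ne: "?U \<noteq> {}" by blast
  have Z: "(\<lambda>_. 0) \<in> ?Z" by auto
  hence Zne: "?Z \<noteq> {}" by blast
  have "weighted_star_discrepancy w N s x \<le> \<epsilon>"
    unfolding weighted_star_discrepancy_def
  proof (rule cSUP_least[OF Zne])
    fix z assume "z \<in> ?Z"
    thus "?M x z \<le> \<epsilon>" using U ne small by (subst Max_le_iff) auto
  qed
  moreover have "0 \<le> weighted_star_discrepancy w N s y" if y: "y \<in> point_sets N s" for y
  proof -
    have "?M y z \<le> Max (w ` ?U)" if "z \<in> ?Z" for z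
    proof (subst Max_le_iff)
      show "\<forall>a\<in>(\<lambda>u. w u * \<bar>discrepancy_fun N s y (project_one u z)\<bar>) ` ?U. a \<le> Max (w ` ?U)"
      proof clarify
        fix u assume u: "u \<noteq> {}" "u \<subseteq> {1..s}"
        have "w u * \<bar>discrepancy_fun N s y (project_one u z)\<bar> \<le> w u"
          using discrepancy_fun_abs_le_1[OF u(2) y that] assms(3)[OF u(2)] by (simp add: mult_left_le)
        also have "\<dots> \<le> Max (w ` ?U)" using u U by (intro Max_ge) auto
        finally show "w u * \<bar>discrepancy_fun N s y (project_one u z)\<bar> \<le> Max (w ` ?U)" .
      qed
    qed (use U ne in auto)
    hence "bdd_above (?M y ` ?Z)" by (intro bdd_aboveI2)
    hence "?M y (\<lambda>_. 0) \<le> weighted_star_discrepancy w N s y"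
      unfolding weighted_star_discrepancy_def using Z by (intro cSUP_upper) auto
    moreover have "0 \<le> w {1..s} * \<bar>discrepancy_fun N s y (project_one {1..s} (\<lambda>_. 0))\<bar>"
      using assms(3) by auto
    moreover have "\<dots> \<le> ?M y (\<lambda>_. 0)" using U by (intro Max_ge) auto
    ultimately show ?thesis by linarith
  qed
  hence "bdd_below (weighted_star_discrepancy w N s ` point_sets N s)" by (intro bdd_belowI2)
  hence "disc w N s \<le> weighted_star_discrepancy w N s x"
    unfolding disc_def using assms(2) by (intro cINF_lower)
  ultimately show ?thesis by linarith
qed

text \<open>
  The factor \<open>exp (card u)\<close> keeps the weights a product, so the sum is still bounded
  independently of \<open>s\<close> once the \<open>\<gamma> j\<close> are summable. It makes heavy sets small: a set of weight
  above \<open>\<epsilon>\<close> has cardinality at most the logarithm of the bound divided by \<open>\<epsilon>\<close>.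
\<close>

lemma sum_product_weights_le:
  assumes "\<And>j. j \<in> {1..s} \<Longrightarrow> 0 \<le> \<gamma> j"
  shows "(\<Sum>u\<in>Pow {1..s}. exp (card u) * product_weights \<gamma> u) \<le> exp (exp 1 * (\<Sum>j\<in>{1..s}. \<gamma> j))"
proof -
  have "(\<Sum>u\<in>Pow {1..s}. exp (card u) * product_weights \<gamma> u)
      = (\<Sum>u\<in>Pow {1..s}. \<Prod>j\<in>u. exp 1 * \<gamma> j)"
    by (simp add: product_weights_def prod.distrib exp_of_nat_mult[symmetric])
  also have "\<dots> = (\<Prod>j\<in>{1..s}. 1 + exp 1 * \<gamma> j)"
    by (simp add: prod_add add.commute[of 1])
  also have "\<dots> \<le> exp (\<Sum>j\<in>{1..s}. exp 1 * \<gamma> j)"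
    using assms by (intro prod_le_exp_sum) auto
  finally show ?thesis by (simp add: sum_distrib_left)
qed

text \<open>
  Only the family \<open>U\<close> of sets of weight above \<open>\<epsilon>\<close> has to be treated. With \<open>R = D / \<epsilon>\<close> and
  \<open>M = ln (5 * R)\<close> it has at most \<open>R\<close> members, of cardinality at most \<open>M\<close>, and a mesh with
  \<open>m + 1 \<le> (5 * R)\<^sup>2 = exp (2 * M)\<close> is fine enough, so that twice the number of boxes is at most
  \<open>exp (M + 2 * M\<^sup>2) \<le> exp (3 * M\<^sup>2)\<close>. Balancing and rounding each contribute at most
  \<open>\<epsilon> / (2 * D)\<close>, and \<open>D\<close> bounds every weight.
\<close>

lemma disc_le_of_large_N:
  fixes w :: "nat set \<Rightarrow> real"
  assumes "1 \<le> s" "0 < \<epsilon>" "\<epsilon> < 1" "1 \<le> D"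
    and w: "\<And>u. u \<subseteq> {1..s} \<Longrightarrow> 0 \<le> w u"
    and sum: "(\<Sum>u\<in>Pow {1..s}. exp (card u) * w u) \<le> D"
    and N: "48 * (D / \<epsilon>)\<^sup>2 * (ln (5 * D / \<epsilon>))\<^sup>2 \<le> real N"
  shows "disc w N s \<le> \<epsilon>"
proof -
  define M where "M = ln (5 * D / \<epsilon>)"
  define R where "R = D / \<epsilon>"
  have R: "1 < R" "D < R" "0 < R"
    using assms(2-4) by (auto simp: R_def field_simps intro: less_le_trans mult_strict_left_mono)
  have expM: "exp M = 5 * R" unfolding M_def R_def using assms(2,4) by simp
  \<comment> \<open>The factor 5 in \<open>M\<close> ensures this as well as the bounds on the mesh and on the number of sets.\<close>
  have M1: "1 \<le> M"
  proof -
    have "exp 1 \<le> exp M" using exp_le R expM by linarith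
    thus ?thesis by simp
  qed
  define U where "U = {u \<in> Pow {1..s}. \<epsilon> < w u}"
  have le_D: "exp (card u) * w u \<le> D" if "u \<in> Pow {1..s}" for u
  proof -
    have "exp (card u) * w u \<le> (\<Sum>u\<in>Pow {1..s}. exp (card u) * w u)"
      using that w by (intro member_le_sum) auto
    thus ?thesis using sum by linarith
  qed
  have wD: "w u \<le> D" if "u \<in> Pow {1..s}" for u
  proof -
    have "1 * w u \<le> exp (card u) * w u" using w that by (intro mult_right_mono) auto
    thus ?thesis using le_D[OF that] by simp
  qed
  have exp_card: "exp (card u) \<le> R" if "u \<in> U" for u
  proof -
    have "exp (card u) * \<epsilon> \<le> exp (card u) * w u" using that by (intro mult_left_mono) (auto simp: U_def)
    also have "\<dots> \<le> D" using le_D that by (auto simp: U_def)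
    finally show ?thesis using assms(2) by (simp add: R_def field_simps)
  qed
  have cardM: "real (card u) \<le> M" if "u \<in> U" for u
  proof -
    have "exp (card u) \<le> exp M" using exp_card[OF that] expM R by linarith
    thus ?thesis by simp
  qed
  have cardR: "real (card u) \<le> R" if "u \<in> U" for u
    using exp_card[OF that] exp_ge_add_one_self[of "card u"] by linarith
  have cardU: "real (card U) \<le> R"
  proof -
    have "card U * \<epsilon> = (\<Sum>u\<in>U. \<epsilon>)" by simp
    also have "\<dots> \<le> (\<Sum>u\<in>U. exp (card u) * w u)"
    proof (rule sum_mono)
      fix u assume "u \<in> U"
      hence "\<epsilon> < w u" "0 \<le> w u" using assms(2) by (auto simp: U_def)
      moreover have "1 * w u \<le> exp (card u) * w u" using \<open>0 \<le> w u\<close> by (intro mult_right_mono) auto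
      ultimately show "\<epsilon> \<le> exp (card u) * w u" by simp
    qed
    also have "\<dots> \<le> (\<Sum>u\<in>Pow {1..s}. exp (card u) * w u)"
      using w by (intro sum_mono2) (auto simp: U_def)
    finally show ?thesis using sum assms(2) by (simp add: R_def field_simps)
  qed
  \<comment> \<open>Makes \<open>card u / m \<le> R / (2 * R\<^sup>2) = \<epsilon> / (2 * D)\<close>, from the bound \<open>card u \<le> R\<close>.\<close>
  define m where "m = nat \<lceil>2 * R\<^sup>2\<rceil>"
  have R2: "1 \<le> R\<^sup>2" using R by simp
  have m: "2 * R\<^sup>2 \<le> m" "m \<le> 2 * R\<^sup>2 + 1" using R2 unfolding m_def by linarith+
  have m0: "0 < m" using m R2 by (cases m) auto
  have m_exp: "real (m + 1) \<le> exp (2 * M)"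
  proof -
    have "exp (2 * M) = (5 * R)\<^sup>2" using expM by (simp add: exp_double)
    thus ?thesis using m R2 by (simp add: power_mult_distrib)
  qed
  have "2 * (\<Sum>u\<in>U. real (m + 1) ^ card u) \<le> 2 * (\<Sum>u\<in>U. exp (2 * M * M))"
  proof (intro mult_left_mono sum_mono)
    fix u assume u: "u \<in> U"
    have "real (m + 1) ^ card u \<le> exp (2 * M) ^ card u" using m_exp by (intro power_mono) auto
    also have "\<dots> = exp (card u * (2 * M))" by (simp add: exp_of_nat_mult)
    also have "\<dots> \<le> exp (M * (2 * M))" using cardM[OF u] M1 by simp
    finally show "real (m + 1) ^ card u \<le> exp (2 * M * M)" by (simp add: mult_ac)
  qed auto
  also have "\<dots> = (2 * card U) * exp (2 * M * M)" by simp
  also have "\<dots> \<le> exp M * exp (2 * M * M)" using cardU expM R by (intro mult_right_mono) auto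
  also have "\<dots> = exp (M + 2 * M * M)" by (simp add: exp_add)
  also have "\<dots> \<le> exp (N * (\<epsilon> / (2 * D))\<^sup>2 / 4)"
  proof -
    have "N * (\<epsilon> / (2 * D))\<^sup>2 / 4 = N / (16 * R\<^sup>2)"
      using assms(2,4) by (simp add: R_def field_simps power2_eq_square)
    moreover have "3 * M\<^sup>2 \<le> N / (16 * R\<^sup>2)"
      using N R by (simp add: M_def R_def[symmetric] field_simps)
    moreover have "M \<le> M * M" using M1 by simp
    ultimately show ?thesis by (simp add: power2_eq_square)
  qed
  finally have large: "2 * (\<Sum>u\<in>U. real (m + 1) ^ card u) \<le> exp (N * (\<epsilon> / (2 * D))\<^sup>2 / 4)" .
  have "0 < 48 * (D / \<epsilon>)\<^sup>2 * (ln (5 * D / \<epsilon>))\<^sup>2"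
    using M1 R by (simp add: M_def[symmetric] R_def[symmetric])
  hence "0 < real N" using N by linarith
  hence N0: "0 < N" by simp
  have U: "U \<subseteq> Pow {1..s}" by (auto simp: U_def)
  have \<eta>: "0 < \<epsilon> / (2 * D)" "\<epsilon> / (2 * D) \<le> 1" using assms(2-4) by auto
  obtain x where x: "x \<in> point_sets N s"
    and xU: "\<forall>u\<in>U. \<forall>z\<in>{1..s} \<rightarrow> {0..1}.
      \<bar>discrepancy_fun N s x (project_one u z)\<bar> \<le> \<epsilon> / (2 * D) + card u / m"
    by (rule bexE[OF exists_low_discrepancy_points[OF U m0 N0 \<eta> large]])
  show ?thesis
  proof (rule disc_le[OF assms(1) x w])
    fix u :: "nat set" and z :: "nat \<Rightarrow> real"
    assume u: "u \<noteq> {}" "u \<subseteq> {1..s}" and z: "z \<in> {1..s} \<rightarrow> {0..1}"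
    let ?d = "\<bar>discrepancy_fun N s x (project_one u z)\<bar>"
    show "w u * ?d \<le> \<epsilon>"
    proof (cases "u \<in> U")
      case True
      have "card u / m \<le> R / (2 * R\<^sup>2)"
        using cardR[OF True] m R by (intro frac_le) auto
      also have "\<dots> = \<epsilon> / (2 * D)"
        using assms(2,4) by (simp add: R_def field_simps power2_eq_square)
      finally have "?d \<le> \<epsilon> / D" using bspec[OF bspec[OF xU True] z] by simp
      hence "w u * ?d \<le> D * (\<epsilon> / D)"
        using wD[of u] u assms(4) by (intro mult_mono) auto
      thus ?thesis using assms(4) by simp
    next
      case False
      have "w u * ?d \<le> w u"
        using discrepancy_fun_abs_le_1[OF u(2) x z] w[OF u(2)] by (simp add: mult_left_le)
      thus ?thesis using False u by (auto simp: U_def)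
    qed
  qed auto
qed

text \<open>
  The number of points required by \<open>disc_le_of_large_N\<close> exceeds \<open>\<epsilon> powr (-2)\<close> by a squared
  logarithm, which costs at most a factor of order \<open>\<epsilon> powr (- (\<alpha> - 2))\<close>.
\<close>

lemma tractability_bound_of_summable:
  fixes \<gamma> :: "nat \<Rightarrow> real"
  assumes pos: "\<And>j. 1 \<le> j \<Longrightarrow> 0 \<le> \<gamma> j" and sm: "summable (\<lambda>j. \<gamma> (Suc j))" and "2 < \<alpha>"
  shows "\<exists>C\<ge>0. tractability_bound (product_weights \<gamma>) C \<alpha>"
proof -
  define D where "D = exp (exp 1 * (\<Sum>j. \<gamma> (Suc j)))"
  have D1: "1 \<le> D" using pos by (simp add: D_def suminf_nonneg[OF sm])
  have sumD: "(\<Sum>u\<in>Pow {1..s}. exp (card u) * product_weights \<gamma> u) \<le> D" for s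
  proof -
    have "(\<Sum>j\<in>{1..s}. \<gamma> j) = (\<Sum>j<s. \<gamma> (Suc j))"
      by (simp add: sum.atLeast1_atMost_eq)
    also have "\<dots> \<le> (\<Sum>j. \<gamma> (Suc j))" using pos by (intro sum_le_suminf sm) auto
    finally have "exp (exp 1 * (\<Sum>j\<in>{1..s}. \<gamma> j)) \<le> D" by (simp add: D_def)
    thus ?thesis using sum_product_weights_le[of s \<gamma>] pos by fastforce
  qed
  \<comment> \<open>The logarithm enters squared, so half of the excess over 2 is available for each factor.\<close>
  define \<theta> where "\<theta> = (\<alpha> - 2) / 2"
  have \<theta>: "0 < \<theta>" using assms(3) by (simp add: \<theta>_def)
  define C where "C = 49 * D\<^sup>2 * (5 * D) powr (\<alpha> - 2) / \<theta>\<^sup>2"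
  have "ereal_of_enat (N_min (product_weights \<gamma>) \<epsilon> s) \<le> ereal (C * \<epsilon> powr (- \<alpha>))"
    if s: "1 \<le> s" and e: "0 < \<epsilon>" "\<epsilon> < 1" for s :: nat and \<epsilon> :: real
  proof -
    define R where "R = D / \<epsilon>"
    define M where "M = ln (5 * R)"
    define N where "N = nat \<lceil>48 * R\<^sup>2 * M\<^sup>2\<rceil>"
    have R: "1 \<le> R" using D1 e by (simp add: R_def field_simps)
    have M1: "1 \<le> M"
    proof -
      have "exp 1 \<le> 5 * R" using exp_le R by linarith
      thus ?thesis using R by (simp add: M_def ln_ge_iff)
    qed
    have RM: "1 \<le> R\<^sup>2 * M\<^sup>2" using R M1 mult_mono[of 1 "R\<^sup>2" 1 "M\<^sup>2"] by simp
    have N: "48 * R\<^sup>2 * M\<^sup>2 \<le> N" "N \<le> 48 * R\<^sup>2 * M\<^sup>2 + 1"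
      using RM unfolding N_def by linarith+
    have "0 < real N" using N RM by linarith
    hence "1 \<le> N" by simp
    moreover have "disc (product_weights \<gamma>) N s \<le> \<epsilon>"
    proof (rule disc_le_of_large_N[OF s e D1 _ sumD])
      show "0 \<le> product_weights \<gamma> u" if "u \<subseteq> {1..s}" for u
        using pos that by (auto simp: product_weights_def intro!: prod_nonneg)
      show "48 * (D / \<epsilon>)\<^sup>2 * (ln (5 * D / \<epsilon>))\<^sup>2 \<le> real N"
        using N(1) by (simp add: M_def R_def)
    qed
    ultimately have "N_min (product_weights \<gamma>) \<epsilon> s \<le> enat N"
      unfolding N_min_def by (intro INF_lower) auto
    hence "ereal_of_enat (N_min (product_weights \<gamma>) \<epsilon> s) \<le> ereal (real N)"
      by (metis ereal_of_enat_le_iff ereal_of_enat_simps(1))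
    also have "real N \<le> C * \<epsilon> powr (- \<alpha>)"
    proof -
      have "M \<le> (5 * R) powr \<theta> / \<theta>"
        unfolding M_def using R \<theta> by (intro ln_powr_bound) auto
      hence "M\<^sup>2 \<le> ((5 * R) powr \<theta> / \<theta>)\<^sup>2" using M1 by (intro power_mono) auto
      also have "\<dots> = (5 * R) powr (\<alpha> - 2) / \<theta>\<^sup>2"
      proof -
        have "((5 * R) powr \<theta>)\<^sup>2 = (5 * R) powr (\<theta> + \<theta>)"
          by (simp only: power2_eq_square powr_add)
        also have "\<theta> + \<theta> = \<alpha> - 2" by (simp add: \<theta>_def)
        finally show ?thesis by (simp add: power_divide)
      qed
      finally have "49 * R\<^sup>2 * M\<^sup>2 \<le> 49 * R\<^sup>2 * ((5 * R) powr (\<alpha> - 2) / \<theta>\<^sup>2)"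
        by (intro mult_left_mono) auto
      also have "\<dots> = C * (\<epsilon> powr (- 2) * \<epsilon> powr (- (\<alpha> - 2)))"
      proof -
        have "5 * R = 5 * D * inverse \<epsilon>" by (simp add: R_def field_simps)
        hence "(5 * R) powr (\<alpha> - 2) = (5 * D) powr (\<alpha> - 2) * \<epsilon> powr (- (\<alpha> - 2))"
          using D1 e by (simp add: powr_mult inverse_powr powr_minus[of \<epsilon> "\<alpha> - 2", symmetric])
        moreover have "R\<^sup>2 = D\<^sup>2 * \<epsilon> powr (- 2)"
          using e by (simp add: R_def divide_inverse power_mult_distrib power_inverse powr_minus powr_numeral)
        ultimately show ?thesis by (simp add: C_def mult_ac)
      qed
      also have "\<dots> = C * \<epsilon> powr (- \<alpha>)" using e by (simp add: powr_add[symmetric])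
      finally show ?thesis using N(2) RM by linarith
    qed
    finally show ?thesis by simp
  qed
  moreover have "0 \<le> C" using D1 by (simp add: C_def)
  ultimately show ?thesis unfolding tractability_bound_def by (intro exI[of _ C]) auto
qed

theorem mainTheorem3:
  fixes \<gamma> :: "nat \<Rightarrow> real"
  assumes "\<And>j. 1 \<le> j \<Longrightarrow> 0 < \<gamma> j"
    and "\<And>i j. 1 \<le> i \<Longrightarrow> i \<le> j \<Longrightarrow> \<gamma> j \<le> \<gamma> i"
    and "summable (\<lambda>j. \<gamma> (Suc j))"
  shows "strongly_polynomially_tractable (product_weights \<gamma>) \<and>
         eps_exponent (product_weights \<gamma>) \<le> 2"
proof
  have bound: "\<exists>C\<ge>0. tractability_bound (product_weights \<gamma>) C \<alpha>" if "2 < \<alpha>" for \<alpha>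
    using tractability_bound_of_summable[OF _ assms(3) that] assms(1) by (simp add: less_imp_le)
  obtain C where "0 \<le> C" "tractability_bound (product_weights \<gamma>) C 3" using bound[of 3] by auto
  thus "strongly_polynomially_tractable (product_weights \<gamma>)"
    unfolding strongly_polynomially_tractable_def by (intro exI[of _ C] exI[of _ 3] conjI) auto
  have le: "eps_exponent (product_weights \<gamma>) \<le> ereal \<alpha>" if "2 < \<alpha>" for \<alpha>
    unfolding eps_exponent_def using bound[OF that] that by (intro INF_lower) auto
  have "eps_exponent (product_weights \<gamma>) \<le> 2 + ereal e" if "0 < e" for e
  proof -
    have "ereal (2 + e) = 2 + ereal e"
      by (simp only: plus_ereal.simps(1)[symmetric] numeral_eq_ereal)
    thus ?thesis using le[of "2 + e"] that by (simp only: less_add_same_cancel1)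
  qed
  thus "eps_exponent (product_weights \<gamma>) \<le> 2"
    by (rule ereal_le_epsilon2)
qed

end
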